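(* Let $n$ be a positive integer. Every $f\in P^n(D,\mathbb{B})$ is representable as $$f=\sum_{k=0}^{n-1}\widehat{z^*}^{\,k}\,\varphi_k,$$ where $\varphi_k\in Hol(D,\mathbb{B})$ for each $k$.
   Context: $D$ is the open unit disk in $\mathbb{C}$. For $u=x+iy\in\mathbb{C}$ ($x,y\in\mathbb{R}$), $u^*=x-iy$ is the complex conjugate. $\mathbb{B}$ denotes the bicomplex numbers: the commutative $\mathbb{C}$-algebra of elements $z_1+jz_2$ with $z_1,z_2\in\mathbb{C}$, $j^2=-1$, $ij=ji$. The bicomplexification of $u=x+iy\in\mathbb{C}$ is $\widehat{u}=x+jy\in\mathbb{B}$; thus $\widehat{z^*}=x-jy$ for $z=x+iy$. The operator $\bar\partial=\frac12(\partial_x+j\partial_y)$ acts on functions $D\to\mathbb{B}$. $Hol(D,\mathbb{B})$ is the set of $f:D\to\mathbb{B}$ with $\bar\partial f=0$. $P^n(D,\mathbb{B})$ is the set of $f:D\to\mathbb{B}$ with $\bar\partial^{\,n}f=0$ (functions being regular enough that the derivatives make sense classically, e.g. of class $C^n$). *)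

theory Defs
  imports "HOL-Analysis.Analysis"
begin

section \<open>Bicomplex numbers\<close>

text \<open>\<open>Bicomplex z1 z2\<close> stands for \<open>z1 + j z2\<close>.\<close>

datatype bicomplex = Bicomplex (bc1: complex) (bc2: complex)

lemma bicomplex_eqI: "bc1 a = bc1 b \<Longrightarrow> bc2 a = bc2 b \<Longrightarrow> a = b"
  by (cases a; cases b) simp

lemma bicomplex_eq_iff: "a = b \<longleftrightarrow> bc1 a = bc1 b \<and> bc2 a = bc2 b"
  by (cases a; cases b) simp

instantiation bicomplex :: comm_ring_1
begin

definition "0 = Bicomplex 0 0"
definition "1 = Bicomplex 1 0"
definition "a + b = Bicomplex (bc1 a + bc1 b) (bc2 a + bc2 b)"
definition "- a = Bicomplex (- bc1 a) (- bc2 a)"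
definition "a - b = Bicomplex (bc1 a - bc1 b) (bc2 a - bc2 b)"
definition "a * b = Bicomplex (bc1 a * bc1 b - bc2 a * bc2 b) (bc1 a * bc2 b + bc2 a * bc1 b)"

instance
  by standard
    (simp_all add: zero_bicomplex_def one_bicomplex_def plus_bicomplex_def uminus_bicomplex_def
      minus_bicomplex_def times_bicomplex_def algebra_simps bicomplex_eq_iff)

end

lemma bicomplex_sel_simps [simp]:
  "bc1 0 = 0" "bc2 0 = 0" "bc1 1 = 1" "bc2 1 = 0"
  "bc1 (a + b) = bc1 a + bc1 b" "bc2 (a + b) = bc2 a + bc2 b"
  "bc1 (- a) = - bc1 a" "bc2 (- a) = - bc2 a"
  "bc1 (a - b) = bc1 a - bc1 b" "bc2 (a - b) = bc2 a - bc2 b"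
  "bc1 (a * b) = bc1 a * bc1 b - bc2 a * bc2 b"
  "bc2 (a * b) = bc1 a * bc2 b + bc2 a * bc1 b"
  by (simp_all add: zero_bicomplex_def one_bicomplex_def plus_bicomplex_def uminus_bicomplex_def
      minus_bicomplex_def times_bicomplex_def)

instantiation bicomplex :: real_algebra_1
begin

definition "r *\<^sub>R a = Bicomplex (r *\<^sub>R bc1 a) (r *\<^sub>R bc2 a)"

instance
  by standard (simp_all add: scaleR_bicomplex_def bicomplex_eq_iff algebra_simps)

end

lemma bicomplex_sel_scaleR [simp]:
  "bc1 (r *\<^sub>R a) = r *\<^sub>R bc1 a" "bc2 (r *\<^sub>R a) = r *\<^sub>R bc2 a"
  by (simp_all add: scaleR_bicomplex_def)

text \<open>The norm is the Euclidean one of the underlying four-dimensional real space. It only serves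
  to provide the topology; it is not submultiplicative.\<close>

instantiation bicomplex :: real_normed_vector
begin

definition "norm a = norm (bc1 a, bc2 a)"
definition "sgn (a :: bicomplex) = a /\<^sub>R norm a"
definition "dist (a :: bicomplex) b = norm (a - b)"
definition [code del]:
  "(uniformity :: (bicomplex \<times> bicomplex) filter) = (INF e\<in>{0 <..}. principal {(x, y). dist x y < e})"
definition [code del]:
  "open (U :: bicomplex set) \<longleftrightarrow> (\<forall>x\<in>U. eventually (\<lambda>(x', y). x' = x \<longrightarrow> y \<in> U) uniformity)"

instance
proof
  fix r :: real and a b :: bicomplex and U :: "bicomplex set"
  show "norm a = 0 \<longleftrightarrow> a = 0"
    by (simp add: norm_bicomplex_def bicomplex_eq_iff zero_prod_def)
  show "norm (a + b) \<le> norm a + norm b"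
    using norm_triangle_ineq[of "(bc1 a, bc2 a)" "(bc1 b, bc2 b)"]
    by (simp add: norm_bicomplex_def)
  show "norm (r *\<^sub>R a) = \<bar>r\<bar> * norm a"
    using norm_scaleR[of r "(bc1 a, bc2 a)"]
    by (simp add: norm_bicomplex_def del: norm_scaleR)
qed (rule sgn_bicomplex_def dist_bicomplex_def uniformity_bicomplex_def open_bicomplex_def)+

end

definition bc_of_complex :: "complex \<Rightarrow> bicomplex" where
  "bc_of_complex z = Bicomplex z 0"

definition bc_j :: bicomplex where
  "bc_j = Bicomplex 0 1"

lemma bc_j_squared: "bc_j * bc_j = - 1"
  by (simp add: bc_j_def bicomplex_eq_iff)

lemma Bicomplex_eq: "Bicomplex z1 z2 = bc_of_complex z1 + bc_j * bc_of_complex z2"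
  by (simp add: bc_j_def bc_of_complex_def bicomplex_eq_iff)

text \<open>Bicomplexification replaces \<open>i\<close> by \<open>j\<close>. It differs from the embedding
  \<^const>\<open>bc_of_complex\<close>, which keeps \<open>i\<close>.\<close>

definition bc_hat :: "complex \<Rightarrow> bicomplex" where
  "bc_hat u = of_real (Re u) + bc_j * of_real (Im u)"


section \<open>Differential operators\<close>

definition partial_x :: "(complex \<Rightarrow> 'b::real_normed_vector) \<Rightarrow> complex \<Rightarrow> 'b" where
  "partial_x f z = vector_derivative (\<lambda>x. f (Complex x (Im z))) (at (Re z))"

definition partial_y :: "(complex \<Rightarrow> 'b::real_normed_vector) \<Rightarrow> complex \<Rightarrow> 'b" where
  "partial_y f z = vector_derivative (\<lambda>y. f (Complex (Re z) y)) (at (Im z))"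

definition dbar :: "(complex \<Rightarrow> bicomplex) \<Rightarrow> complex \<Rightarrow> bicomplex" where
  "dbar f z = (1 / 2) *\<^sub>R (partial_x f z + bc_j * partial_y f z)"

text \<open>\<open>Ck_on k f S\<close>, meant for open \<open>S\<close>: \<open>f\<close> is of class \<open>C^k\<close> on \<open>S\<close> in the real sense.
  Functions are total, but for open \<open>S\<close> the values outside \<open>S\<close> are irrelevant, both here and
  for \<^const>\<open>dbar\<close> and its iterates at points of \<open>S\<close>.\<close>

fun Ck_on :: "nat \<Rightarrow> (complex \<Rightarrow> 'b::real_normed_vector) \<Rightarrow> complex set \<Rightarrow> bool" where
  "Ck_on 0 f S \<longleftrightarrow> continuous_on S f"
| "Ck_on (Suc k) f S \<longleftrightarrow>
     (\<forall>z\<in>S. f differentiable (at z)) \<and> Ck_on k (partial_x f) S \<and> Ck_on k (partial_y f) S"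

definition poly_hol :: "nat \<Rightarrow> complex set \<Rightarrow> (complex \<Rightarrow> bicomplex) set" where
  "poly_hol n S = {f. Ck_on n f S \<and> (\<forall>z\<in>S. (dbar ^^ n) f z = 0)}"

definition bc_hol :: "complex set \<Rightarrow> (complex \<Rightarrow> bicomplex) set" where
  "bc_hol S = {f. Ck_on 1 f S \<and> (\<forall>z\<in>S. dbar f z = 0)}"

end

theory Submission
  imports Defs
begin

text \<open>The coefficients can be written down explicitly. Put \<open>w = bc_hat (cnj z)\<close>. The operator
  \<^const>\<open>dbar\<close> is a derivation with \<open>dbar w = 1\<close>, so for functions of \<open>w\<close> it behaves like
  \<open>d/dw\<close> and its kernel like the constants. Taylor's formula, expanded at the point \<open>w\<close> and
  evaluated at \<open>0\<close>, then gives as \<open>k\<close>-th coefficient of a polynomial in \<open>w\<close>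

  \<open>\<phi>\<^sub>k = (\<Sum>m<n-k. (-1)^m / (k! m!) w^m dbar^(k+m) f)\<close>.

  Applying \<^const>\<open>dbar\<close> to this sum telescopes, and what survives is a multiple of
  \<open>dbar^n f = 0\<close> (\<open>dbar_taylor_sum\<close>). Reassembling \<open>\<Sum>k<n. w^k \<phi>\<^sub>k\<close> along \<open>k + m = N\<close> gives
  \<open>w^N dbar^N f / N!\<close> times \<open>(1 - 1)^N\<close>, so that only \<open>N = 0\<close>, that is \<open>f\<close>, remains
  (\<open>taylor_sums_recombine\<close>).

  An induction on \<open>n\<close> that splits off the top coefficient \<open>dbar^(n-1) f / (n-1)!\<close> would need
  this \<open>C^1\<close> function to be smooth, which is a theorem of Cauchy type. The explicit formula
  contains derivatives of order below \<open>n\<close> only, hence it is visibly of class \<open>C^1\<close>, and the whole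
  proof stays within the product rule.\<close>

section \<open>Bicomplex multiplication as a bounded bilinear map\<close>

lemma norm_bicomplex_components:
  "norm (bc1 a) \<le> norm a" "norm (bc2 a) \<le> norm a" "norm a \<le> norm (bc1 a) + norm (bc2 a)"
  by (simp_all add: norm_bicomplex_def norm_Pair real_sqrt_sum_squares_triangle_ineq sqrt_sum_squares_le_sum)

text \<open>The product rule needs multiplication to be bounded only up to a constant, and such a
  constant exists although the Euclidean norm is not submultiplicative.\<close>

lemma bounded_bilinear_bicomplex_mult:
  "bounded_bilinear ((*) :: bicomplex \<Rightarrow> bicomplex \<Rightarrow> bicomplex)"
proof
  show "\<exists>K. \<forall>a b :: bicomplex. norm (a * b) \<le> norm a * norm b * K"
  proof (intro exI[of _ 4] allI)
    fix a b :: bicomplex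
    have le: "norm (p * q) \<le> norm a * norm b" if "norm p \<le> norm a" "norm q \<le> norm b"
      for p q :: complex
      using that by (simp add: norm_mult mult_mono)
    note c = norm_bicomplex_components
    have "norm (bc1 (a * b)) \<le> 2 * (norm a * norm b)"
      using norm_triangle_ineq4[of "bc1 a * bc1 b" "bc2 a * bc2 b"]
        le[OF c(1)[of a] c(1)[of b]] le[OF c(2)[of a] c(2)[of b]] by simp
    moreover have "norm (bc2 (a * b)) \<le> 2 * (norm a * norm b)"
      using norm_triangle_ineq[of "bc1 a * bc2 b" "bc2 a * bc1 b"]
        le[OF c(1)[of a] c(2)[of b]] le[OF c(2)[of a] c(1)[of b]] by simp
    ultimately show "norm (a * b) \<le> norm a * norm b * 4"
      using c(3)[of "a * b"] by linarith
  qed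
qed (simp_all add: algebra_simps)

interpretation bc_mult: bounded_bilinear "(*) :: bicomplex \<Rightarrow> bicomplex \<Rightarrow> bicomplex"
  by (rule bounded_bilinear_bicomplex_mult)

section \<open>Partial derivatives and classes of differentiability\<close>

lemma partial_x_eq:
  assumes "(f has_derivative D) (at z)"
  shows "partial_x f z = D 1"
proof -
  have "((\<lambda>x. Complex x (Im z)) has_derivative (\<lambda>h. of_real h)) (at (Re z))"
  proof -
    have "((\<lambda>x. of_real x + \<i> * of_real (Im z)) has_derivative (\<lambda>h. of_real h + 0)) (at (Re z))"
      by (intro derivative_intros)
    then show ?thesis by (simp add: complex_eq_iff Complex_eq)
  qed
  then have "((\<lambda>x. f (Complex x (Im z))) has_derivative (\<lambda>h. D (of_real h))) (at (Re z))"
    by (rule has_derivative_compose) (use assms in simp)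
  moreover have "D (of_real h) = h *\<^sub>R D 1" for h
    using linear_scale[OF has_derivative_linear[OF assms], of h 1] by (simp add: scaleR_conv_of_real)
  ultimately have "((\<lambda>x. f (Complex x (Im z))) has_vector_derivative D 1) (at (Re z))"
    by (simp add: has_vector_derivative_def)
  then show ?thesis by (simp add: partial_x_def vector_derivative_at)
qed

lemma partial_y_eq:
  assumes "(f has_derivative D) (at z)"
  shows "partial_y f z = D \<i>"
proof -
  have "((\<lambda>y. Complex (Re z) y) has_derivative (\<lambda>h. \<i> * of_real h)) (at (Im z))"
  proof -
    have "((\<lambda>y. of_real (Re z) + \<i> * of_real y) has_derivative (\<lambda>h. 0 + \<i> * of_real h)) (at (Im z))"
      by (intro derivative_intros)
    then show ?thesis by (simp add: complex_eq_iff Complex_eq)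
  qed
  then have "((\<lambda>y. f (Complex (Re z) y)) has_derivative (\<lambda>h. D (\<i> * of_real h))) (at (Im z))"
    by (rule has_derivative_compose) (use assms in simp)
  moreover have "D (\<i> * of_real h) = h *\<^sub>R D \<i>" for h
    using linear_scale[OF has_derivative_linear[OF assms], of h \<i>]
    by (simp add: scaleR_conv_of_real mult.commute)
  ultimately have "((\<lambda>y. f (Complex (Re z) y)) has_vector_derivative D \<i>) (at (Im z))"
    by (simp add: has_vector_derivative_def)
  then show ?thesis by (simp add: partial_y_def vector_derivative_at)
qed

lemma dbar_eq:
  assumes "(f has_derivative D) (at z)"
  shows "dbar f z = (1/2) *\<^sub>R (D 1 + bc_j * D \<i>)"
  by (simp add: dbar_def partial_x_eq[OF assms] partial_y_eq[OF assms])

lemma has_derivative_cong_open: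
  assumes "open S" "z \<in> S" "\<And>x. x \<in> S \<Longrightarrow> f x = g x"
  shows "(f has_derivative D) (at z) \<longleftrightarrow> (g has_derivative D) (at z)"
  using assms has_derivative_transform_within_open[of f D z UNIV S g]
    has_derivative_transform_within_open[of g D z UNIV S f] by auto

text \<open>Derivation rules for partial derivatives hold at the points of \<open>S\<close> only. This congruence
  rule lets them be used inside the recursive definition of \<^const>\<open>Ck_on\<close>.\<close>

lemma Ck_on_cong:
  assumes "open S" "Ck_on k f S" "\<And>x. x \<in> S \<Longrightarrow> f x = g x"
  shows "Ck_on k g S"
  using assms(2,3)
proof (induction k arbitrary: f g)
  case 0
  then show ?case by (simp add: continuous_on_cong[of S S f g])
next
  case (Suc k)
  have D: "\<exists>D. (f has_derivative D) (at z) \<and> (g has_derivative D) (at z)" if "z \<in> S" for z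
  proof -
    obtain D where "(f has_derivative D) (at z)"
      using Suc.prems(1) \<open>z \<in> S\<close> by (auto simp: differentiable_def)
    with has_derivative_cong_open[of S z f g D] assms(1) \<open>z \<in> S\<close> Suc.prems(2) show ?thesis
      by blast
  qed
  have "partial_x f z = partial_x g z" "partial_y f z = partial_y g z" if "z \<in> S" for z
    using D[OF that] by (auto simp: partial_x_eq partial_y_eq)
  moreover have "g differentiable at z" if "z \<in> S" for z
    using D[OF that] by (auto simp: differentiable_def)
  ultimately show ?case using Suc by (auto intro: Suc.IH)
qed

lemma Ck_on_Suc_imp: "Ck_on (Suc k) f S \<Longrightarrow> Ck_on k f S"
proof (induction k arbitrary: f)
  case 0
  then show ?case
    by (auto intro!: continuous_at_imp_continuous_on differentiable_imp_continuous_within)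
next
  case (Suc k)
  then show ?case by (metis Ck_on.simps(2))
qed

lemma Ck_on_mono: "Ck_on n f S \<Longrightarrow> m \<le> n \<Longrightarrow> Ck_on m f S"
  by (induction n) (auto simp: le_Suc_eq dest: Ck_on_Suc_imp simp del: Ck_on.simps)

lemma Ck_on_imp_has_derivative:
  assumes "Ck_on (Suc k) f S" "z \<in> S"
  obtains D where "(f has_derivative D) (at z)"
  using assms by (auto simp: differentiable_def)

text \<open>Closure of \<open>C^k\<close> under a pointwise operation follows by recursion once the derivative of
  the result and its two partial derivatives are known.\<close>

lemma Ck_on_SucI:
  assumes S: "open S"
    and D: "\<And>z. z \<in> S \<Longrightarrow> \<exists>D. (f has_derivative D) (at z) \<and> D 1 = fx z \<and> D \<i> = fy z"
    and Ck: "Ck_on k fx S" "Ck_on k fy S"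
  shows "Ck_on (Suc k) f S"
proof -
  have "f differentiable at z" "partial_x f z = fx z" "partial_y f z = fy z" if "z \<in> S" for z
    using D[OF that] by (auto simp: partial_x_eq partial_y_eq differentiable_def)
  then show ?thesis
    using Ck_on_cong[OF S Ck(1), of "partial_x f"] Ck_on_cong[OF S Ck(2), of "partial_y f"] by simp
qed

lemma Ck_on_const:
  assumes "open S"
  shows "Ck_on k (\<lambda>z. c) S"
proof (induction k arbitrary: c)
  case (Suc k)
  show ?case
    by (rule Ck_on_SucI[OF assms _ Suc Suc, of _ 0 0]) (auto intro!: exI[of _ "\<lambda>_. 0"])
qed simp

lemma Ck_on_bounded_linear:
  assumes "open S" "bounded_linear L"
  shows "Ck_on k L S"
proof (cases k)
  case 0
  then show ?thesis using assms by (simp add: linear_continuous_on)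
next
  case (Suc m)
  have "Ck_on (Suc m) L S"
    by (rule Ck_on_SucI[OF assms(1) _ Ck_on_const Ck_on_const, of _ "L 1" "L \<i>"])
      (use assms in \<open>auto intro!: exI[of _ L] bounded_linear_imp_has_derivative\<close>)
  then show ?thesis using Suc by simp
qed

lemma Ck_on_compose_bounded_linear:
  assumes "open S" "bounded_linear L"
  shows "Ck_on k f S \<Longrightarrow> Ck_on k (\<lambda>z. L (f z)) S"
proof (induction k arbitrary: f)
  case 0
  then show ?case using bounded_linear.continuous_on[OF assms(2)] by simp
next
  case (Suc k)
  have "Ck_on k (partial_x f) S" "Ck_on k (partial_y f) S" using Suc.prems by auto
  from this[THEN Suc.IH] show ?case
  proof (rule Ck_on_SucI[OF assms(1), rotated])
    fix z assume "z \<in> S"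
    then obtain D where D: "(f has_derivative D) (at z)"
      using Suc.prems by (blast elim: Ck_on_imp_has_derivative)
    show "\<exists>D. ((\<lambda>z. L (f z)) has_derivative D) (at z)
        \<and> D 1 = L (partial_x f z) \<and> D \<i> = L (partial_y f z)"
      using bounded_linear.has_derivative[OF assms(2) D]
      by (auto simp: partial_x_eq[OF D] partial_y_eq[OF D])
  qed
qed

lemma Ck_on_add:
  assumes "open S"
  shows "Ck_on k f S \<Longrightarrow> Ck_on k g S \<Longrightarrow> Ck_on k (\<lambda>z. f z + g z) S"
proof (induction k arbitrary: f g)
  case 0
  then show ?case by (simp add: continuous_on_add)
next
  case (Suc k)
  have "Ck_on k (\<lambda>z. partial_x f z + partial_x g z) S" "Ck_on k (\<lambda>z. partial_y f z + partial_y g z) S"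
    using Suc by auto
  then show ?case
  proof (rule Ck_on_SucI[OF assms(1), rotated])
    fix z assume "z \<in> S"
    then obtain D E where D: "(f has_derivative D) (at z)" "(g has_derivative E) (at z)"
      using Suc.prems by (meson Ck_on_imp_has_derivative)
    then show "\<exists>D. ((\<lambda>z. f z + g z) has_derivative D) (at z)
        \<and> D 1 = partial_x f z + partial_x g z \<and> D \<i> = partial_y f z + partial_y g z"
      by (intro exI[of _ "\<lambda>h. D h + E h"]) (auto simp: partial_x_eq partial_y_eq intro: has_derivative_add)
  qed
qed

lemma Ck_on_sum:
  assumes "open S" "\<And>i. i \<in> A \<Longrightarrow> Ck_on k (f i) S"
  shows "Ck_on k (\<lambda>z. \<Sum>i\<in>A. f i z) S"
  using assms(2)
  by (induction A rule: infinite_finite_induct) (auto intro: Ck_on_add Ck_on_const assms(1))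

lemma Ck_on_mult:
  fixes f g :: "complex \<Rightarrow> bicomplex"
  assumes "open S"
  shows "Ck_on k f S \<Longrightarrow> Ck_on k g S \<Longrightarrow> Ck_on k (\<lambda>z. f z * g z) S"
proof (induction k arbitrary: f g)
  case 0
  then show ?case by (simp add: bc_mult.continuous_on)
next
  case (Suc k)
  have "Ck_on k f S" "Ck_on k g S" "Ck_on k (partial_x f) S" "Ck_on k (partial_y f) S"
    "Ck_on k (partial_x g) S" "Ck_on k (partial_y g) S"
    using Suc.prems Suc.prems[THEN Ck_on_Suc_imp] by auto
  then have "Ck_on k (\<lambda>z. f z * partial_x g z + partial_x f z * g z) S"
    "Ck_on k (\<lambda>z. f z * partial_y g z + partial_y f z * g z) S"
    by (simp_all add: Ck_on_add[OF assms] Suc.IH)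
  then show ?case
  proof (rule Ck_on_SucI[OF assms(1), rotated])
    fix z assume "z \<in> S"
    then obtain D E where D: "(f has_derivative D) (at z)" "(g has_derivative E) (at z)"
      using Suc.prems by (meson Ck_on_imp_has_derivative)
    then show "\<exists>D. ((\<lambda>z. f z * g z) has_derivative D) (at z)
        \<and> D 1 = f z * partial_x g z + partial_x f z * g z
        \<and> D \<i> = f z * partial_y g z + partial_y f z * g z"
      using bc_mult.FDERIV[OF D] by (auto simp: partial_x_eq partial_y_eq)
  qed
qed

lemma Ck_on_power:
  fixes f :: "complex \<Rightarrow> bicomplex"
  assumes "open S" "Ck_on k f S"
  shows "Ck_on k (\<lambda>z. f z ^ m) S"
  by (induction m) (auto intro: Ck_on_mult Ck_on_const assms)

section \<open>The operator dbar as a derivation\<close>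

lemma Ck_on_dbar:
  assumes "open S" "Ck_on (Suc k) f S"
  shows "Ck_on k (dbar f) S"
proof -
  have "Ck_on k (\<lambda>z. (1/2) *\<^sub>R (partial_x f z + bc_j * partial_y f z)) S"
    using assms
    by (intro Ck_on_compose_bounded_linear[OF _ bounded_linear_scaleR_right] Ck_on_add
        Ck_on_compose_bounded_linear[OF _ bc_mult.bounded_linear_right]) auto
  then show ?thesis by (simp add: dbar_def[abs_def])
qed

lemma Ck_on_dbar_funpow:
  assumes "open S"
  shows "Ck_on (m + k) f S \<Longrightarrow> Ck_on k ((dbar ^^ m) f) S"
proof (induction m arbitrary: k)
  case (Suc m)
  then have "Ck_on (Suc k) ((dbar ^^ m) f) S" by (simp del: Ck_on.simps)
  then show ?case using Ck_on_dbar[OF assms] by simp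
qed simp

lemma dbar_const: "dbar (\<lambda>z. c) z = 0"
  by (simp add: dbar_eq[OF has_derivative_const])

lemma dbar_add:
  assumes "f differentiable at z" "g differentiable at z"
  shows "dbar (\<lambda>z. f z + g z) z = dbar f z + dbar g z"
proof -
  obtain D E where D: "(f has_derivative D) (at z)" "(g has_derivative E) (at z)"
    using assms by (auto simp: differentiable_def)
  show ?thesis
    by (simp add: dbar_eq[OF D(1)] dbar_eq[OF D(2)] dbar_eq[OF has_derivative_add[OF D]]
        algebra_simps flip: scaleR_add_right)
qed

lemma dbar_scaleR:
  assumes "f differentiable at z"
  shows "dbar (\<lambda>z. c *\<^sub>R f z) z = c *\<^sub>R dbar f z"
proof -
  obtain D where D: "(f has_derivative D) (at z)"
    using assms by (auto simp: differentiable_def)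
  show ?thesis
    by (simp add: dbar_eq[OF D] dbar_eq[OF has_derivative_scaleR_right[OF D]] algebra_simps)
qed

lemma dbar_sum:
  assumes "\<And>i. i \<in> A \<Longrightarrow> f i differentiable at z"
  shows "dbar (\<lambda>z. \<Sum>i\<in>A. f i z) z = (\<Sum>i\<in>A. dbar (f i) z)"
  using assms
  by (induction A rule: infinite_finite_induct) (auto simp: dbar_const dbar_add)

lemma differentiable_bc_mult:
  fixes f g :: "complex \<Rightarrow> bicomplex"
  assumes "f differentiable at z" "g differentiable at z"
  shows "(\<lambda>z. f z * g z) differentiable at z"
  using assms bc_mult.FDERIV by (fastforce simp: differentiable_def)

lemma dbar_mult:
  assumes "f differentiable at z" "g differentiable at z"
  shows "dbar (\<lambda>z. f z * g z) z = dbar f z * g z + f z * dbar g z"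
proof -
  obtain D E where D: "(f has_derivative D) (at z)" "(g has_derivative E) (at z)"
    using assms by (auto simp: differentiable_def)
  show ?thesis
    by (simp add: dbar_eq[OF D(1)] dbar_eq[OF D(2)] dbar_eq[OF bc_mult.FDERIV[OF D]]
        algebra_simps)
qed

lemma bounded_linear_bc_hat_cnj: "bounded_linear (\<lambda>z. bc_hat (cnj z))"
proof (rule linear_conv_bounded_linear[THEN iffD1])
  show "linear (\<lambda>z. bc_hat (cnj z))"
    by (rule linearI) (simp_all add: bc_hat_def algebra_simps of_real_def)
qed

lemma dbar_bc_hat_cnj: "dbar (\<lambda>z. bc_hat (cnj z)) z = 1"
  unfolding dbar_eq[OF bounded_linear_imp_has_derivative[OF bounded_linear_bc_hat_cnj]]
  by (simp add: bc_hat_def bc_j_squared flip: scaleR_2)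

lemma differentiable_bc_hat_cnj_power: "(\<lambda>z. bc_hat (cnj z) ^ m) differentiable at z"
  using Ck_on_power[OF open_UNIV Ck_on_bounded_linear[OF open_UNIV bounded_linear_bc_hat_cnj], of 1 m]
  by simp

lemma dbar_bc_hat_cnj_power:
  "dbar (\<lambda>z. bc_hat (cnj z) ^ m) z = real m *\<^sub>R bc_hat (cnj z) ^ (m - 1)"
proof (induction m)
  case (Suc m)
  have "dbar (\<lambda>z. bc_hat (cnj z) ^ Suc m) z
      = bc_hat (cnj z) ^ m + bc_hat (cnj z) * (real m *\<^sub>R bc_hat (cnj z) ^ (m - 1))"
    using dbar_mult[of "\<lambda>z. bc_hat (cnj z)" z "\<lambda>z. bc_hat (cnj z) ^ m"]
      differentiable_bc_hat_cnj_power[of 1 z] differentiable_bc_hat_cnj_power[of m z]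
    by (simp add: dbar_bc_hat_cnj Suc)
  then show ?case by (cases m) (simp_all add: scaleR_conv_of_real algebra_simps)
qed (simp add: dbar_const)

section \<open>Taylor coefficients with respect to the conjugate variable\<close>

definition taylor_coeff :: "nat \<Rightarrow> nat \<Rightarrow> real" where
  "taylor_coeff k m = (-1) ^ m / (fact k * fact m)"

text \<open>The two parts of the product rule for consecutive \<open>m\<close> cancel because
  \<open>Suc m * taylor_coeff k (Suc m) = - taylor_coeff k m\<close>; only the last term is left.\<close>

lemma dbar_taylor_sum:
  assumes "\<And>m. m \<le> M \<Longrightarrow> (dbar ^^ (k + m)) f differentiable at z"
  shows "dbar (\<lambda>z. \<Sum>m<Suc M. taylor_coeff k m *\<^sub>R (bc_hat (cnj z) ^ m * (dbar ^^ (k + m)) f z)) z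
    = taylor_coeff k M *\<^sub>R (bc_hat (cnj z) ^ M * (dbar ^^ (k + Suc M)) f z)"
proof -
  define w where "w = bc_hat (cnj z)"
  define g where "g m = (dbar ^^ (k + m)) f z" for m
  have diff: "(\<lambda>z. bc_hat (cnj z) ^ m * (dbar ^^ (k + m)) f z) differentiable at z"
    if "m \<le> M" for m
    by (intro differentiable_bc_mult differentiable_bc_hat_cnj_power assms that)
  have "dbar (\<lambda>z. \<Sum>m<Suc M. taylor_coeff k m *\<^sub>R (bc_hat (cnj z) ^ m * (dbar ^^ (k + m)) f z)) z
      = (\<Sum>m<Suc M. dbar (\<lambda>z. taylor_coeff k m *\<^sub>R (bc_hat (cnj z) ^ m * (dbar ^^ (k + m)) f z)) z)"
    by (rule dbar_sum) (auto intro!: diff differentiable_scaleR)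
  also have "\<dots> = (\<Sum>m<Suc M. taylor_coeff k m *\<^sub>R ((real m *\<^sub>R w ^ (m - 1)) * g m + w ^ m * g (Suc m)))"
  proof (rule sum.cong)
    fix m assume "m \<in> {..<Suc M}"
    then have "m \<le> M" by simp
    then show "dbar (\<lambda>z. taylor_coeff k m *\<^sub>R (bc_hat (cnj z) ^ m * (dbar ^^ (k + m)) f z)) z
        = taylor_coeff k m *\<^sub>R ((real m *\<^sub>R w ^ (m - 1)) * g m + w ^ m * g (Suc m))"
      by (simp add: dbar_scaleR[OF diff] dbar_mult[OF differentiable_bc_hat_cnj_power assms]
          dbar_bc_hat_cnj_power w_def g_def)
  qed simp
  also have "\<dots> = taylor_coeff k M *\<^sub>R (w ^ M * g (Suc M))"
  proof (induction M)
    case (Suc M)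
    have c: "taylor_coeff k (Suc M) * real (Suc M) = - taylor_coeff k M"
      by (simp add: taylor_coeff_def divide_simps del: of_nat_Suc)
    have "taylor_coeff k (Suc M) *\<^sub>R ((real (Suc M) *\<^sub>R w ^ M) * g (Suc M))
        = - (taylor_coeff k M *\<^sub>R (w ^ M * g (Suc M)))"
      by (simp only: mult_scaleR_left scaleR_scaleR c scaleR_minus_left)
    then show ?case
      by (subst sum.lessThan_Suc, subst Suc) (simp add: scaleR_add_right)
  qed simp
  finally show ?thesis by (simp add: w_def g_def)
qed

text \<open>Up to the factor \<open>1 / N!\<close> this is the binomial expansion of \<open>(1 - 1)^N\<close>.\<close>

lemma sum_taylor_coeff: "(\<Sum>k\<le>N. taylor_coeff k (N - k)) = (if N = 0 then 1 else 0)"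
proof -
  have "fact N * (\<Sum>k\<le>N. taylor_coeff k (N - k)) = (\<Sum>k\<le>N. of_nat (N choose k) * 1 ^ k * (-1) ^ (N - k))"
    unfolding sum_distrib_left
    by (rule sum.cong) (auto simp: taylor_coeff_def binomial_fact)
  also have "\<dots> = (1 + (- 1 :: real)) ^ N" by (rule binomial_ring[symmetric])
  finally show ?thesis by (cases N) (auto simp: taylor_coeff_def)
qed

lemma taylor_sums_recombine:
  fixes w :: "'a :: {real_algebra_1, comm_ring_1}" and g :: "nat \<Rightarrow> 'a"
  assumes "n > 0"
  shows "(\<Sum>k<n. w ^ k * (\<Sum>m<n - k. taylor_coeff k m *\<^sub>R (w ^ m * g (k + m)))) = g 0"
proof -
  have "(\<Sum>k<n. w ^ k * (\<Sum>m<n - k. taylor_coeff k m *\<^sub>R (w ^ m * g (k + m))))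
      = (\<Sum>k<n. \<Sum>m<n - k. taylor_coeff k m *\<^sub>R (w ^ (k + m) * g (k + m)))"
    by (simp add: sum_distrib_left power_add mult.assoc)
  also have "\<dots> = (\<Sum>(k, m)\<in>{(k, m). k + m < n}. taylor_coeff k m *\<^sub>R (w ^ (k + m) * g (k + m)))"
    by (subst sum.Sigma) (auto intro!: sum.cong)
  also have "\<dots> = (\<Sum>N<n. \<Sum>k\<le>N. taylor_coeff k (N - k) *\<^sub>R (w ^ N * g N))"
    by (subst sum.triangle_reindex) simp
  also have "\<dots> = (\<Sum>N<n. if N = 0 then g 0 else 0)"
    by (rule sum.cong) (auto simp: sum_taylor_coeff simp flip: scaleR_sum_left)
  also have "\<dots> = g 0" using assms by simp
  finally show ?thesis .
qed

theorem theorem5p3: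
  fixes n :: nat and f :: "complex \<Rightarrow> bicomplex"
  assumes "n > 0" and "f \<in> poly_hol n (ball 0 1)"
  shows "\<exists>\<phi> :: nat \<Rightarrow> complex \<Rightarrow> bicomplex.
           (\<forall>k<n. \<phi> k \<in> bc_hol (ball 0 1)) \<and>
           (\<forall>z\<in>ball 0 1. f z = (\<Sum>k<n. bc_hat (cnj z) ^ k * \<phi> k z))"
proof -
  let ?S = "ball 0 1 :: complex set"
  define \<phi> where "\<phi> k z =
    (\<Sum>m<n - k. taylor_coeff k m *\<^sub>R (bc_hat (cnj z) ^ m * (dbar ^^ (k + m)) f z))" for k z
  have S: "open ?S" by simp
  have f: "Ck_on n f ?S" "\<And>z. z \<in> ?S \<Longrightarrow> (dbar ^^ n) f z = 0"
    using assms by (auto simp: poly_hol_def)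
  have C1: "Ck_on 1 ((dbar ^^ m) f) ?S" if "m < n" for m
    by (rule Ck_on_dbar_funpow[OF S]) (use Ck_on_mono[OF f(1), of "m + 1"] that in simp)
  have "\<phi> k \<in> bc_hol ?S" if k: "k < n" for k
  proof -
    have "Ck_on 1 (\<phi> k) ?S"
      unfolding \<phi>_def
      by (intro Ck_on_sum S Ck_on_compose_bounded_linear[OF _ bounded_linear_scaleR_right]
          Ck_on_mult Ck_on_power C1 Ck_on_bounded_linear bounded_linear_bc_hat_cnj) auto
    moreover have "dbar (\<phi> k) z = 0" if z: "z \<in> ?S" for z
    proof -
      from k obtain M where M: "n - k = Suc M" by (metis Suc_diff_Suc)
      then have n: "k + Suc M = n" by simp
      have "(dbar ^^ (k + m)) f differentiable at z" if "m \<le> M" for m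
        using C1[of "k + m"] z that n by auto
      from dbar_taylor_sum[of M k f z, OF this] show ?thesis
        by (simp only: \<phi>_def[abs_def] M n f(2)[OF z] mult_zero_right scaleR_zero_right)
    qed
    ultimately show ?thesis by (simp add: bc_hol_def)
  qed
  moreover have "f z = (\<Sum>k<n. bc_hat (cnj z) ^ k * \<phi> k z)" for z
    unfolding \<phi>_def using taylor_sums_recombine[OF assms(1), of _ "\<lambda>m. (dbar ^^ m) f z"] by simp
  ultimately show ?thesis by blast
qed

end
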